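(* Let $M$ be a smooth surface in $\mathbb{R}^3$ and let $(G,p)$ be a regular framework on $M$ with $n$ vertices such that $(K_n,p)$ is also regular on $M$. Then $(G,p)$ is infinitesimally rigid if and only if it is continuously rigid.
   Context: Frameworks. A smooth surface $M\subset\mathbb{R}^3$ is a smooth embedded two-dimensional submanifold, not necessarily connected. For a finite simple connected graph $G=(V,E)$ with $V=\{v_1,\dots,v_n\}$, a framework $(G,p)$ on $M$ is given by $p=(p_1,\dots,p_n)\in M^n$, with $p_i$ the point assigned to $v_i$. $K_n$ denotes the complete graph on $V$, and $(K_n,p)$ the complete framework on the same points. Continuous rigidity. $V_M(G,p)$ is the set of $q\in M^n$ with $|q_i-q_j|^2=|p_i-p_j|^2$ for all edges $v_iv_j$ of $G$. $(G,p)$ is continuously rigid if for every continuous path $p:[0,1]\to V_M(G,p)$ with $p(0)=p$ there is $\delta>0$ with $p([0,\delta))\subseteq V_M(K_n,p)$. Regularity. Near each $p_i$ let $M$ be given by $h_i=0$, where $h_i$ is a smooth function near $p_i$ with nonvanishing gradient. The augmented edge function is $\tilde f_G(q)=\big((|q_i-q_j|^2)_{v_iv_j\in E},h_1(q_1),\dots,h_n(q_n)\big)$, defined for $q\in\mathbb{R}^{3n}$ near $p$. $(G,p)$ is regular on $M$ if the rank of the derivative $D\tilde f_G$ at $p$ is maximal among its ranks at points of some neighbourhood of $p$ in $\mathbb{R}^{3n}$. Infinitesimal rigidity. The rigidity matrix is the $(|E|+n)\times 3n$ matrix $R_M(G,p)=\frac12 D\tilde f_G(p)$. When $(G,p)$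 and $(K_n,p)$ are regular, $(G,p)$ is infinitesimally rigid if $\dim\ker R_M(G,p)=\dim\ker R_M(K_n,p)$. *)

theory Defs
  imports "HOL-Analysis.Analysis"
begin

section \<open>Smooth maps and smooth surfaces\<close>

text \<open>The predicates \<open>C_k_on\<close> and \<open>smooth_on\<close> are meant for open sets. For finite-dimensional
  domains, continuity of all directional derivatives is continuity of the derivative.\<close>

primrec C_k_on :: "nat \<Rightarrow> ('a::real_normed_vector \<Rightarrow> 'b::real_normed_vector) \<Rightarrow> 'a set \<Rightarrow> bool"
  where
    "C_k_on 0 f S \<longleftrightarrow> continuous_on S f"
  | "C_k_on (Suc k) f S \<longleftrightarrow> (\<forall>x\<in>S. f differentiable (at x)) \<and>
       (\<forall>v. C_k_on k (\<lambda>x. frechet_derivative f (at x) v) S)"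

definition smooth_on :: "('a::real_normed_vector \<Rightarrow> 'b::real_normed_vector) \<Rightarrow> 'a set \<Rightarrow> bool"
  where "smooth_on f S \<longleftrightarrow> (\<forall>k. C_k_on k f S)"

text \<open>Embedded two-dimensional submanifolds of three-space, by slice charts.\<close>

definition smooth_surface :: "(real^3) set \<Rightarrow> bool"
  where "smooth_surface M \<longleftrightarrow>
    (\<forall>x\<in>M. \<exists>U V \<phi> \<psi>. open U \<and> x \<in> U \<and> open (V :: (real^3) set) \<and>
       homeomorphism U V \<phi> \<psi> \<and> smooth_on \<phi> U \<and> smooth_on \<psi> V \<and>
       \<phi> ` (M \<inter> U) = {y \<in> V. y $ 3 = 0})"

definition local_equation :: "(real^3) set \<Rightarrow> real^3 \<Rightarrow> (real^3 \<Rightarrow> real) \<Rightarrow> bool"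
  where "local_equation M x f \<longleftrightarrow>
    (\<exists>U. open U \<and> x \<in> U \<and> smooth_on f U \<and> M \<inter> U = {y \<in> U. f y = 0} \<and>
       (\<forall>y\<in>U. frechet_derivative f (at y) \<noteq> (\<lambda>v. 0)))"


section \<open>Graphs and frameworks\<close>

text \<open>The vertex set is the finite type \<open>'n\<close>, so that \<open>n = CARD('n)\<close>; a graph is given by its
  set of edges, which are two-element sets of vertices. A configuration is an element of
  \<open>real^3^'n\<close>, playing the role of \<open>\<real>\<^sup>3\<^sup>n\<close>.\<close>

definition simple_graph :: "'n::finite set set \<Rightarrow> bool"
  where "simple_graph E \<longleftrightarrow> (\<forall>e\<in>E. card e = 2)"

definition connected_graph :: "'n::finite set set \<Rightarrow> bool"
  where "connected_graph E \<longleftrightarrow> (\<forall>u v. (u, v) \<in> {(a, b). {a, b} \<in> E}\<^sup>*)"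

definition complete_graph :: "'n::finite set set"
  where "complete_graph = {e. card e = 2}"

definition framework_on :: "(real^3) set \<Rightarrow> 'n::finite set set \<Rightarrow> real^3^'n \<Rightarrow> bool"
  where "framework_on M E p \<longleftrightarrow>
    simple_graph E \<and> connected_graph E \<and> (\<forall>i. p $ i \<in> M)"


section \<open>Continuous rigidity\<close>

definition V_on :: "(real^3) set \<Rightarrow> 'n::finite set set \<Rightarrow> real^3^'n \<Rightarrow> (real^3^'n) set"
  where "V_on M E p = {q. (\<forall>i. q $ i \<in> M) \<and>
    (\<forall>i j. {i, j} \<in> E \<longrightarrow> (norm (q $ i - q $ j))\<^sup>2 = (norm (p $ i - p $ j))\<^sup>2)}"

definition continuously_rigid :: "(real^3) set \<Rightarrow> 'n::finite set set \<Rightarrow> real^3^'n \<Rightarrow> bool"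
  where "continuously_rigid M E p \<longleftrightarrow>
    (\<forall>\<gamma>. path \<gamma> \<and> path_image \<gamma> \<subseteq> V_on M E p \<and> pathstart \<gamma> = p \<longrightarrow>
      (\<exists>\<delta>>0. \<delta> \<le> 1 \<and> \<gamma> ` {0..<\<delta>} \<subseteq> V_on M complete_graph p))"


section \<open>Regularity and infinitesimal rigidity\<close>

text \<open>The squared length of an edge \<open>e = {i, j}\<close>, written without choosing an order of the
  endpoints; see the lemma below.\<close>

definition edge_sqlength :: "real^3^'n::finite \<Rightarrow> 'n set \<Rightarrow> real"
  where "edge_sqlength q e = (\<Sum>i\<in>e. \<Sum>j\<in>e. (norm (q $ i - q $ j))\<^sup>2) / 2"

lemma edge_sqlength_pair: "edge_sqlength q {i, j} = (norm (q $ i - q $ j))\<^sup>2"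
  by (cases "i = j") (simp_all add: edge_sqlength_def norm_minus_commute)

text \<open>The coordinates are indexed by the sum of all sets of vertices and all vertices, and the
  coordinates at sets that are not edges are identically zero. This adds only zero rows to the
  derivative, which change neither its rank nor its kernel. The function \<open>h i\<close> is a local
  equation of the surface near \<open>p $ i\<close>; only its values near \<open>p $ i\<close> matter.\<close>

definition aug_edge_fun ::
    "('n \<Rightarrow> real^3 \<Rightarrow> real) \<Rightarrow> 'n::finite set set \<Rightarrow> real^3^'n \<Rightarrow> real^('n set + 'n)"
  where "aug_edge_fun h E q =
    (\<chi> r. case r of Inl e \<Rightarrow> if e \<in> E then edge_sqlength q e else 0 | Inr i \<Rightarrow> h i (q $ i))"

definition derivative_rank ::
    "('n \<Rightarrow> real^3 \<Rightarrow> real) \<Rightarrow> 'n::finite set set \<Rightarrow> real^3^'n \<Rightarrow> nat"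
  where "derivative_rank h E q = dim (range (frechet_derivative (aug_edge_fun h E) (at q)))"

definition regular_framework ::
    "('n \<Rightarrow> real^3 \<Rightarrow> real) \<Rightarrow> 'n::finite set set \<Rightarrow> real^3^'n \<Rightarrow> bool"
  where "regular_framework h E p \<longleftrightarrow>
    (\<exists>N. open N \<and> p \<in> N \<and> (\<forall>q\<in>N. derivative_rank h E q \<le> derivative_rank h E p))"

text \<open>The column \<open>(i, k)\<close> belongs to the \<open>k\<close>-th coordinate of the \<open>i\<close>-th point.\<close>

definition rigidity_matrix ::
    "('n \<Rightarrow> real^3 \<Rightarrow> real) \<Rightarrow> 'n::finite set set \<Rightarrow> real^3^'n \<Rightarrow> real^('n \<times> 3)^('n set + 'n)"
  where "rigidity_matrix h E p = (\<chi> r c. 1/2 *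
    frechet_derivative (aug_edge_fun h E) (at p) (axis (fst c) (axis (snd c) 1)) $ r)"

definition infinitesimally_rigid ::
    "('n \<Rightarrow> real^3 \<Rightarrow> real) \<Rightarrow> 'n::finite set set \<Rightarrow> real^3^'n \<Rightarrow> bool"
  where "infinitesimally_rigid h E p \<longleftrightarrow>
    dim {v. rigidity_matrix h E p *v v = 0} = dim {v. rigidity_matrix h complete_graph p *v v = 0}"

end

theory Submission
  imports Defs
begin

text \<open>
  Write \<open>f\<close> for the augmented edge function of the graph \<open>E\<close> and \<open>k\<close> for that of the complete
  graph. Near \<open>p\<close> the configurations on \<open>M\<close> with the edge lengths of \<open>p\<close> are the points of the
  fibre of \<open>f\<close> through \<open>p\<close>, and those with all distances of \<open>p\<close> are the points of the fibre of \<open>k\<close>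
  (\<open>mem_V_on_iff_aug_edge_fun_eq\<close>). Since \<open>f\<close> is \<open>k\<close> followed by a coordinate projection,
  \<open>ker Dk(p)\<close> is contained in \<open>ker Df(p)\<close>, so equality of dimensions in the definition of
  infinitesimal rigidity says that \<open>ker Df(p)\<close> is contained in \<open>ker Dk(p)\<close>
  (\<open>infinitesimally_rigid_iff_kernel_le\<close>).

  The analytic input is the part of the constant rank theorem given in \<open>fibre_of_maximal_rank\<close>: if a
  \<open>C\<^sup>1\<close> map \<open>F\<close> has maximal rank at \<open>p\<close>, then a local chart \<open>g\<close> with \<open>g(0) = p\<close> and
  \<open>Dg(0) = id\<close> sends small vectors of \<open>ker DF(p)\<close> into the fibre of \<open>F\<close> through \<open>p\<close>. Moreover, if a
  linear map \<open>P\<close> is injective on the range of \<open>DF(p)\<close>, then near \<open>p\<close> the fibres of \<open>F\<close> and of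
  \<open>P \<circ> F\<close> through \<open>p\<close> coincide.

  If the framework is continuously rigid and \<open>Df(p)v = 0\<close>, the chart for \<open>F = f\<close> turns the segment
  towards a small multiple of \<open>v\<close> into a path of configurations with the edge lengths of \<open>p\<close>. By
  rigidity \<open>k\<close> is constant on an initial piece of this path, and differentiating at \<open>p\<close> gives
  \<open>Dk(p)v = 0\<close>. Conversely, if \<open>ker Df(p)\<close> is contained in \<open>ker Dk(p)\<close>, the projection from \<open>k\<close> to
  \<open>f\<close> is injective on the range of \<open>Dk(p)\<close>. With \<open>F = k\<close> the two fibres agree near \<open>p\<close>, and every
  path starting at \<open>p\<close> stays near \<open>p\<close> for some time.
\<close>

section \<open>Fibres of a map of maximal rank\<close>

text \<open>A linear right inverse \<open>R\<close> of \<open>L\<close> on its range satisfies the first equation; passing to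
  \<open>R \<circ> L \<circ> R\<close> also gives the second, which makes the range of \<open>T\<close> a complement of the kernel
  of \<open>L\<close>.\<close>

lemma reflexive_generalized_inverse_exists:
  fixes L :: "'a::euclidean_space \<Rightarrow> 'b::euclidean_space"
  assumes "linear L"
  obtains T where "linear T" "\<And>x. L (T (L x)) = L x" "\<And>y. T (L (T y)) = T y"
proof -
  obtain R where "linear R" and R: "\<And>x. L (R (L x)) = L x"
    using linear_exists_right_inverse_on[OF assms subspace_UNIV] by blast
  have "linear (R \<circ> L \<circ> R)"
    by (intro linear_compose assms \<open>linear R\<close>)
  then show thesis
    by (rule that) (simp_all add: R)
qed

text \<open>Surjectivity keeps the rank of \<open>T \<circ> A\<close> at least that of \<open>L\<close>, since \<open>Q\<close> only contributes vectors
  killed by \<open>L\<close>. If \<open>A\<close> has no larger rank than \<open>L\<close>, then \<open>T\<close> cannot lose dimension on the range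
  of \<open>A\<close>. With \<open>A\<close> a derivative near a point of maximal rank and \<open>L\<close> the derivative at that point,
  this replaces the statement that the rank is locally constant.\<close>

lemma injective_on_range_if_rank_le:
  fixes A L :: "'a::euclidean_space \<Rightarrow> 'b::euclidean_space" and T :: "'b \<Rightarrow> 'a" and Q :: "'a \<Rightarrow> 'a"
  assumes lin: "linear A" "linear L" "linear T"
    and surj: "surj (\<lambda>x. T (A x) + Q x)"
    and LQ: "\<And>x. L (Q x) = 0"
    and rank: "dim (range A) \<le> dim (range L)"
    and "T (A w) = 0"
  shows "A w = 0"
proof -
  let ?S = "range A"
  have subS: "subspace ?S"
    by (simp add: lin linear_subspace_image)
  have "range L \<subseteq> L ` (T ` ?S)"
  proof
    fix z assume "z \<in> range L"
    then obtain x where "z = L x" by blast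
    moreover obtain y where "x = T (A y) + Q y"
      using surjD[OF surj, of x] by blast
    ultimately have "z = L (T (A y))"
      using LQ by (simp add: linear_add[OF lin(2)])
    then show "z \<in> L ` (T ` ?S)" by blast
  qed
  then have "dim (range L) \<le> dim (L ` (T ` ?S))"
    by (rule dim_subset)
  also have "\<dots> \<le> dim (T ` ?S)"
    by (rule dim_image_le[OF lin(2)])
  finally have dimT: "dim ?S \<le> dim (T ` ?S)"
    using rank by simp
  obtain R where R: "range R \<subseteq> ?S" "linear R" "\<forall>v\<in>T ` ?S. T (R v) = v"
    using linear_exists_right_inverse_on[OF lin(3) subS] by blast
  have "subspace (T ` ?S)"
    by (simp add: subS lin linear_subspace_image)
  then have "span (T ` ?S) = T ` ?S"
    by (rule span_eq_iff[THEN iffD2])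
  moreover have "inj_on R (T ` ?S)"
    using R(3) by (auto intro: inj_on_inverseI)
  ultimately have "dim (R ` T ` ?S) = dim (T ` ?S)"
    using dim_image_eq[OF R(2), of "T ` ?S"] by (simp only:)
  then have "R ` T ` ?S = ?S"
    using dimT R(1) subS \<open>subspace (T ` ?S)\<close> R(2) lin
    by (intro subspace_dim_equal linear_subspace_image) auto
  then obtain v where "v \<in> T ` ?S" "A w = R v"
    by blast
  then have "v = 0"
    using R(3) \<open>T (A w) = 0\<close> by force
  then show ?thesis
    using \<open>A w = R v\<close> R(2) by (simp add: linear_0)
qed

text \<open>Let \<open>L\<close> be the derivative of \<open>P \<circ> f\<close> at \<open>p\<close> and \<open>T\<close> a reflexive generalized inverse of \<open>L\<close>, so
  that \<open>Q = id - T \<circ> L\<close> is a projection onto the kernel of \<open>L\<close>. The map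
  \<open>\<Phi>(x) = T (P (f x - f p)) + Q (x - p)\<close> has derivative \<open>id\<close> at \<open>p\<close>, and \<open>g\<close> is its local inverse.
  Points \<open>x\<close> with \<open>P (f x) = P (f p)\<close> are sent into the kernel of \<open>L\<close>, so they lie in the image of
  that kernel under \<open>g\<close>. On this image \<open>f\<close> is constant: there the derivative of \<open>f \<circ> g\<close> in a kernel
  direction is killed by \<open>T \<circ> P\<close>, and the bound on the rank makes \<open>T \<circ> P\<close> injective on the range of
  the derivative of \<open>f\<close>.\<close>

lemma fibre_of_maximal_rank:
  fixes f :: "'a::euclidean_space \<Rightarrow> 'b::euclidean_space" and f' :: "'a \<Rightarrow> 'a \<Rightarrow>\<^sub>L 'b"
    and P :: "'b \<Rightarrow> 'c::euclidean_space"
  assumes "open U" "p \<in> U"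
    and derf: "\<And>x. x \<in> U \<Longrightarrow> (f has_derivative blinfun_apply (f' x)) (at x)"
    and contf: "continuous_on U f'"
    and rank: "\<And>x. x \<in> U \<Longrightarrow> dim (range (blinfun_apply (f' x))) \<le> dim (range (blinfun_apply (f' p)))"
    and "linear P"
    and ker: "\<And>v. P (f' p v) = 0 \<Longrightarrow> f' p v = 0"
  obtains W \<epsilon> g where "open W" "p \<in> W" "\<And>x. x \<in> W \<Longrightarrow> P (f x) = P (f p) \<Longrightarrow> f x = f p"
    and "\<epsilon> > 0" "g 0 = p" "continuous_on (ball 0 \<epsilon>) g" "g ` ball 0 \<epsilon> \<subseteq> U"
    and "(g has_derivative (\<lambda>v. v)) (at 0)"
    and "\<And>y. y \<in> ball 0 \<epsilon> \<Longrightarrow> f' p y = 0 \<Longrightarrow> f (g y) = f p"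
proof -
  define L where "L = P \<circ> blinfun_apply (f' p)"
  have "linear (blinfun_apply (f' x))" for x
    by (simp add: blinfun.bounded_linear_right bounded_linear.linear)
  note linf = this
  have linL: "linear L"
    unfolding L_def by (intro linear_compose linf \<open>linear P\<close>)
  have L0: "L v = 0 \<longleftrightarrow> f' p v = 0" for v
    using ker linear_0[OF \<open>linear P\<close>] by (auto simp: L_def)
  obtain T where linT: "linear T" and LTL: "\<And>x. L (T (L x)) = L x" and TLT: "\<And>y. T (L (T y)) = T y"
    using reflexive_generalized_inverse_exists[OF linL] by blast
  define TP where "TP = T \<circ> P"
  define Q where "Q = (\<lambda>x. x - T (L x))"
  have linTP: "linear TP"
    unfolding TP_def by (intro linear_compose linT \<open>linear P\<close>)
  have linQ: "linear Q"
    unfolding Q_def using linear_compose_sub[OF linear_ident linear_compose[OF linL linT]]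
    by (simp add: o_def)
  have LQ: "L (Q x) = 0" for x
    by (simp add: Q_def linear_diff[OF linL] LTL)
  have blTP: "bounded_linear TP" and blQ: "bounded_linear Q"
    using linTP linQ by (simp_all add: linear_conv_bounded_linear)
  define \<Phi> where "\<Phi> x = TP (f x - f p) + Q (x - p)" for x
  define \<Phi>' where "\<Phi>' x = (Blinfun TP o\<^sub>L f' x) + Blinfun Q" for x
  have \<Phi>'_apply: "\<Phi>' x v = TP (f' x v) + Q v" for x v
    by (simp add: \<Phi>'_def blinfun.add_left bounded_linear_Blinfun_apply blTP blQ)
  have der\<Phi>: "(\<Phi> has_derivative blinfun_apply (\<Phi>' x)) (at x)" if "x \<in> U" for x
  proof -
    have "(\<Phi> has_derivative (\<lambda>v. TP (f' x v - 0) + Q (v - 0))) (at x)"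
      unfolding \<Phi>_def
      by (intro has_derivative_add bounded_linear.has_derivative[OF blTP]
          bounded_linear.has_derivative[OF blQ] has_derivative_diff derf that
          has_derivative_const has_derivative_ident)
    then show ?thesis
      by (simp add: \<Phi>'_apply[abs_def])
  qed
  have cont\<Phi>': "continuous_on U \<Phi>'"
    unfolding \<Phi>'_def by (intro continuous_intros contf)
  have id: "id_blinfun o\<^sub>L \<Phi>' p = id_blinfun"
  proof (rule blinfun_eqI)
    fix v
    have "\<Phi>' p v = T (L v) + Q v"
      by (simp add: \<Phi>'_apply TP_def L_def)
    then show "blinfun_apply (id_blinfun o\<^sub>L \<Phi>' p) v = id_blinfun v"
      by (simp add: Q_def)
  qed
  have \<Phi>p: "\<Phi> p = 0"
    by (simp add: \<Phi>_def linear_0 linTP linQ)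
  obtain U' V g g' where "open U'" "U' \<subseteq> U" "p \<in> U'" "open V" "\<Phi> p \<in> V"
    and hom: "homeomorphism U' V \<Phi> g"
    and derg: "\<And>y. y \<in> V \<Longrightarrow> (g has_derivative (g' y)) (at y)"
    and g': "\<And>y. y \<in> V \<Longrightarrow> g' y = inv (blinfun_apply (\<Phi>' (g y)))"
    and bij: "\<And>y. y \<in> V \<Longrightarrow> bij (blinfun_apply (\<Phi>' (g y)))"
    using inverse_function_theorem[OF \<open>open U\<close> der\<Phi> cont\<Phi>' \<open>p \<in> U\<close> id] by metis
  obtain \<epsilon> where "\<epsilon> > 0" and \<epsilon>: "ball 0 \<epsilon> \<subseteq> V"
    using \<open>open V\<close> \<open>\<Phi> p \<in> V\<close> \<Phi>p by (metis open_contains_ball)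
  have gU: "g y \<in> U'" if "y \<in> V" for y
    using hom that by (auto simp: homeomorphism_def)
  have g0: "g 0 = p"
    using hom \<open>p \<in> U'\<close> \<Phi>p by (metis homeomorphism_apply1)
  have const: "f (g y) = f p" if y: "y \<in> ball 0 \<epsilon>" and "f' p y = 0" for y
  proof -
    have Ly: "L y = 0"
      using that L0 by blast
    have seg: "t *\<^sub>R y \<in> V" if "t \<in> {0..1}" for t :: real
    proof -
      have "norm (t *\<^sub>R y) \<le> norm y"
        using that by (simp add: mult_left_le_one_le)
      then show ?thesis
        using y \<epsilon> by auto
    qed
    have zero: "((\<lambda>t. f (g (t *\<^sub>R y))) has_derivative (\<lambda>s. 0)) (at t within {0..1})"
      if t: "t \<in> {0..1}" for t :: real
    proof -
      let ?q = "g (t *\<^sub>R y)"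
      let ?w = "g' (t *\<^sub>R y) y"
      have q: "?q \<in> U"
        using gU seg[OF t] \<open>U' \<subseteq> U\<close> by blast
      have bl: "bounded_linear (g' (t *\<^sub>R y))"
        using derg[OF seg[OF t]] has_derivative_bounded_linear by blast
      have "\<Phi>' ?q ?w = y"
        using g' bij seg[OF t] by (metis bij_inv_eq_iff)
      then have eq: "TP (f' ?q ?w) + Q ?w = y"
        by (simp add: \<Phi>'_apply)
      then have "L (TP (f' ?q ?w)) + L (Q ?w) = 0"
        using Ly linear_add[OF linL] by metis
      then have "L (T (P (f' ?q ?w))) = 0"
        using LQ by (simp add: TP_def)
      then have TP0: "TP (f' ?q ?w) = 0"
        using TLT linear_0[OF linT] by (metis TP_def comp_apply)
      \<comment> \<open>The identity \<open>T (L (T z)) = T z\<close> has turned \<open>L (T z) = 0\<close> into \<open>T z = 0\<close>; now the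
        bound on the rank cancels \<open>T \<circ> P\<close> in front of the derivative of \<open>f\<close>.\<close>
      have "surj (\<lambda>v. TP (f' ?q v) + Q v)"
        using bij[OF seg[OF t]] by (simp add: \<Phi>'_apply[abs_def] bij_def)
      then have w0: "f' ?q ?w = 0"
        using injective_on_range_if_rank_le[OF linf linf linTP _ _ rank[OF q] TP0] LQ L0 by blast
      have "((\<lambda>t. t *\<^sub>R y) has_derivative (\<lambda>s. s *\<^sub>R y)) (at t)"
        by (auto intro!: derivative_eq_intros)
      then have "((\<lambda>t. g (t *\<^sub>R y)) has_derivative (\<lambda>s. g' (t *\<^sub>R y) (s *\<^sub>R y))) (at t)"
        by (rule has_derivative_compose) (rule derg[OF seg[OF t]])
      then have "((\<lambda>t. f (g (t *\<^sub>R y))) has_derivative (\<lambda>s. f' ?q (g' (t *\<^sub>R y) (s *\<^sub>R y)))) (at t)"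
        by (rule has_derivative_compose) (rule derf[OF q])
      moreover have "f' ?q (g' (t *\<^sub>R y) (s *\<^sub>R y)) = 0" for s
        by (simp add: linear_scale[OF bounded_linear.linear[OF bl]] blinfun.scaleR_right w0)
      ultimately show ?thesis
        by (simp add: has_derivative_at_withinI)
    qed
    have "f (g (1 *\<^sub>R y)) = f (g (0 *\<^sub>R y))"
      by (rule has_derivative_zero_unique[of "{0..1::real}"]) (auto intro: zero)
    then show ?thesis
      by (simp add: g0)
  qed
  show thesis
  proof
    have cont\<Phi>: "continuous_on U' \<Phi>"
      using hom by (simp add: homeomorphism_def)
    show "open (U' \<inter> \<Phi> -` ball 0 \<epsilon>)"
      by (rule continuous_open_preimage[OF cont\<Phi> \<open>open U'\<close> open_ball])
    show "p \<in> U' \<inter> \<Phi> -` ball 0 \<epsilon>"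
      using \<open>p \<in> U'\<close> \<Phi>p \<open>\<epsilon> > 0\<close> by simp
    show "f x = f p" if "x \<in> U' \<inter> \<Phi> -` ball 0 \<epsilon>" "P (f x) = P (f p)" for x
    proof -
      have "\<Phi> x = Q (x - p)"
        using that(2) by (simp add: \<Phi>_def TP_def linear_diff[OF \<open>linear P\<close>] linear_0[OF linT])
      then have "f' p (\<Phi> x) = 0"
        using L0 LQ by simp
      moreover have "g (\<Phi> x) = x"
        using that hom by (auto simp: homeomorphism_def)
      ultimately show ?thesis
        using const[of "\<Phi> x"] that by auto
    qed
    show "continuous_on (ball 0 \<epsilon>) g"
      using hom \<epsilon> by (metis continuous_on_subset homeomorphism_def)
    show "g ` ball 0 \<epsilon> \<subseteq> U"
      using gU \<epsilon> \<open>U' \<subseteq> U\<close> by blast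
    have "blinfun_apply (\<Phi>' p) = (\<lambda>v. v)"
      using arg_cong[OF id, of blinfun_apply] by (simp add: fun_eq_iff)
    then have "g' 0 = (\<lambda>v. v)"
      using g'[of 0] g0 \<Phi>p \<open>\<Phi> p \<in> V\<close> by (simp add: inv_id[unfolded id_def])
    then show "(g has_derivative (\<lambda>v. v)) (at 0)"
      using derg[of 0] \<Phi>p \<open>\<Phi> p \<in> V\<close> by simp
  qed (use \<open>\<epsilon> > 0\<close> g0 const in auto)
qed

section \<open>The derivative of the augmented edge function\<close>

lemma has_derivative_vec_componentwise:
  fixes f :: "'a::real_normed_vector \<Rightarrow> real^'m"
  assumes "\<And>r. ((\<lambda>x. f x $ r) has_derivative (\<lambda>v. f' v $ r)) (at a within S)"
  shows "(f has_derivative f') (at a within S)"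
proof -
  have "((\<lambda>x. f x \<bullet> b) has_derivative (\<lambda>v. f' v \<bullet> b)) (at a within S)" if "b \<in> Basis" for b
    using that assms by (auto simp: Basis_vec_def inner_axis)
  then show ?thesis
    using has_derivative_componentwise_within[of f f' a S] by blast
qed

text \<open>The summand for an edge \<open>{i, j}\<close> is \<open>2 (q\<^sub>i - q\<^sub>j) \<bullet> (v\<^sub>i - v\<^sub>j)\<close>, because the double sum runs
  over both orders of the endpoints.\<close>

definition aug_edge_deriv ::
    "('n \<Rightarrow> real^3 \<Rightarrow> real) \<Rightarrow> 'n::finite set set \<Rightarrow> real^3^'n \<Rightarrow> real^3^'n \<Rightarrow> real^('n set + 'n)"
  where "aug_edge_deriv h E q v =
    (\<chi> r. case r of
        Inl e \<Rightarrow> if e \<in> E then \<Sum>i\<in>e. \<Sum>j\<in>e. (q $ i - q $ j) \<bullet> (v $ i - v $ j) else 0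
      | Inr i \<Rightarrow> frechet_derivative (h i) (at (q $ i)) (v $ i))"

lemma has_derivative_edge_sqlength:
  fixes q :: "real^3^'n::finite"
  shows "((\<lambda>q. edge_sqlength q e) has_derivative
    (\<lambda>v. \<Sum>i\<in>e. \<Sum>j\<in>e. (q $ i - q $ j) \<bullet> (v $ i - v $ j))) (at q)"
proof -
  have nth: "((\<lambda>q. q $ i) has_derivative (\<lambda>v. v $ i)) (at q)" for i
    by (rule bounded_linear.has_derivative[OF bounded_linear_vec_nth has_derivative_ident])
  have "((\<lambda>q. \<Sum>i\<in>e. \<Sum>j\<in>e. (1/2) * ((q $ i - q $ j) \<bullet> (q $ i - q $ j))) has_derivative
      (\<lambda>v. \<Sum>i\<in>e. \<Sum>j\<in>e. (1/2) *
        ((q $ i - q $ j) \<bullet> (v $ i - v $ j) + (v $ i - v $ j) \<bullet> (q $ i - q $ j)))) (at q)"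
    by (intro has_derivative_sum has_derivative_mult_right has_derivative_inner
        has_derivative_diff nth)
  moreover have "(1/2) * (x \<bullet> y + y \<bullet> x) = x \<bullet> y" for x y :: "real^3"
    by (simp add: inner_commute)
  moreover have "edge_sqlength q e = (\<Sum>i\<in>e. \<Sum>j\<in>e. (1/2) * ((q $ i - q $ j) \<bullet> (q $ i - q $ j)))"
    for q :: "real^3^'n"
    unfolding edge_sqlength_def power2_norm_eq_inner by (simp add: sum_divide_distrib)
  ultimately show ?thesis
    by simp
qed

lemma has_derivative_aug_edge_fun:
  assumes "\<And>i. h i differentiable (at (q $ i))"
  shows "(aug_edge_fun h E has_derivative aug_edge_deriv h E q) (at q)"
proof (rule has_derivative_vec_componentwise)
  fix r :: "'a set + 'a"
  show "((\<lambda>x. aug_edge_fun h E x $ r) has_derivative (\<lambda>v. aug_edge_deriv h E q v $ r)) (at q)"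
  proof (cases r)
    case (Inl e)
    then show ?thesis
      by (cases "e \<in> E")
        (simp_all add: aug_edge_fun_def aug_edge_deriv_def has_derivative_edge_sqlength)
  next
    case (Inr i)
    have "(h i has_derivative frechet_derivative (h i) (at (q $ i))) (at (q $ i))"
      using assms frechet_derivative_works by blast
    then have "((\<lambda>x. h i (x $ i)) has_derivative (\<lambda>v. frechet_derivative (h i) (at (q $ i)) (v $ i))) (at q)"
      by (rule has_derivative_compose
          [OF bounded_linear.has_derivative[OF bounded_linear_vec_nth has_derivative_ident]])
    then show ?thesis
      by (simp add: Inr aug_edge_fun_def aug_edge_deriv_def)
  qed
qed

lemma continuous_on_aug_edge_deriv:
  assumes "\<And>i. C_k_on (Suc 0) (h i) (S i)"
  shows "continuous_on {q. \<forall>i. q $ i \<in> S i} (\<lambda>q. aug_edge_deriv h E q v)"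
  unfolding aug_edge_deriv_def
proof (rule continuous_on_vec_lambda)
  fix r :: "'a set + 'a"
  show "continuous_on {q. \<forall>i. q $ i \<in> S i} (\<lambda>q. case r of
        Inl e \<Rightarrow> if e \<in> E then \<Sum>i\<in>e. \<Sum>j\<in>e. (q $ i - q $ j) \<bullet> (v $ i - v $ j) else 0
      | Inr i \<Rightarrow> frechet_derivative (h i) (at (q $ i)) (v $ i))"
  proof (cases r)
    case (Inl e)
    then show ?thesis
      by (cases "e \<in> E") (auto intro!: continuous_intros)
  next
    case (Inr i)
    have "continuous_on (S i) (\<lambda>x. frechet_derivative (h i) (at x) (v $ i))"
      using assms[of i] by simp
    then have "continuous_on {q. \<forall>i. q $ i \<in> S i}
        (\<lambda>q. frechet_derivative (h i) (at (q $ i)) (v $ i))"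
      by (rule continuous_on_compose2) (auto intro!: continuous_intros)
    then show ?thesis
      by (simp add: Inr)
  qed
qed

section \<open>Subgraphs of the complete graph\<close>

definition edge_proj :: "'n::finite set set \<Rightarrow> real^('n set + 'n) \<Rightarrow> real^('n set + 'n)"
  where "edge_proj E z = (\<chi> r. case r of Inl e \<Rightarrow> if e \<in> E then z $ r else 0 | Inr i \<Rightarrow> z $ r)"

lemma linear_edge_proj: "linear (edge_proj E)"
  by (rule linearI) (auto simp: edge_proj_def vec_eq_iff split: sum.split)

lemma edge_proj_aug_edge_fun:
  assumes "simple_graph E"
  shows "edge_proj E (aug_edge_fun h complete_graph q) = aug_edge_fun h E q"
  using assms
  by (auto simp: edge_proj_def aug_edge_fun_def vec_eq_iff simple_graph_def complete_graph_def
      split: sum.split)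

lemma edge_proj_aug_edge_deriv:
  assumes "simple_graph E"
  shows "edge_proj E (aug_edge_deriv h complete_graph q v) = aug_edge_deriv h E q v"
  using assms
  by (auto simp: edge_proj_def aug_edge_deriv_def vec_eq_iff simple_graph_def complete_graph_def
      split: sum.split)

text \<open>Where the functions \<open>h i\<close> are equations of \<open>M\<close>, the frameworks equivalent to \<open>p\<close> form a fibre, since
  a point lies on \<open>M\<close> exactly when \<open>h i\<close> takes the value \<open>0\<close> that it has at \<open>p $ i\<close>.\<close>

lemma mem_V_on_iff_aug_edge_fun_eq:
  assumes "simple_graph E"
    and "\<And>i. p $ i \<in> M \<inter> S i" "\<And>i. q $ i \<in> S i"
    and "\<And>i. M \<inter> S i = {y \<in> S i. h i y = 0}"
  shows "q \<in> V_on M E p \<longleftrightarrow> aug_edge_fun h E q = aug_edge_fun h E p"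
proof -
  have "p $ i \<in> {y \<in> S i. h i y = 0}" for i
    using assms(2) assms(4) by blast
  then have hp: "h i (p $ i) = 0" for i
    by blast
  have hq: "q $ i \<in> M \<longleftrightarrow> h i (q $ i) = 0" for i
    using assms(3,4) by blast
  have "(\<forall>i j. {i, j} \<in> E \<longrightarrow> (norm (q $ i - q $ j))\<^sup>2 = (norm (p $ i - p $ j))\<^sup>2)
      \<longleftrightarrow> (\<forall>e\<in>E. edge_sqlength q e = edge_sqlength p e)"
    (is "?L \<longleftrightarrow> ?R")
  proof
    assume ?L
    show ?R
    proof
      fix e assume "e \<in> E"
      then obtain i j where "e = {i, j}"
        using assms(1) by (auto simp: simple_graph_def card_2_iff)
      then show "edge_sqlength q e = edge_sqlength p e"
        using \<open>?L\<close> \<open>e \<in> E\<close> by (simp add: edge_sqlength_pair)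
    qed
  next
    assume ?R
    then show ?L
      by (metis edge_sqlength_pair)
  qed
  moreover have "aug_edge_fun h E q = aug_edge_fun h E p \<longleftrightarrow>
      (\<forall>e\<in>E. edge_sqlength q e = edge_sqlength p e) \<and> (\<forall>i. h i (q $ i) = 0)"
    by (auto simp: aug_edge_fun_def vec_eq_iff hp split: sum.splits)
  ultimately show ?thesis
    by (auto simp: V_on_def hq)
qed

lemma rigidity_matrix_mult:
  assumes "linear (frechet_derivative (aug_edge_fun h E) (at p))"
  shows "rigidity_matrix h E p *v x
    = (1/2) *\<^sub>R frechet_derivative (aug_edge_fun h E) (at p) (\<chi> i k. x $ (i, k))"
proof -
  let ?D = "frechet_derivative (aug_edge_fun h E) (at p)"
  have "(\<chi> i k. x $ (i, k)) = (\<Sum>c\<in>UNIV. x $ c *\<^sub>R axis (fst c) (axis (snd c) (1::real)))"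
  proof -
    have "(\<Sum>c\<in>UNIV. x $ c *\<^sub>R axis (fst c) (axis (snd c) (1::real))) $ i $ k = x $ (i, k)" for i k
    proof -
      have "(\<Sum>c\<in>UNIV. x $ c *\<^sub>R axis (fst c) (axis (snd c) (1::real))) $ i $ k
          = (\<Sum>c\<in>UNIV. if c = (i, k) then x $ c else 0)"
        unfolding sum_component by (intro sum.cong) (auto simp: axis_def)
      then show ?thesis
        by simp
    qed
    then show ?thesis
      by (simp add: vec_eq_iff)
  qed
  then have "?D (\<chi> i k. x $ (i, k)) = (\<Sum>c\<in>UNIV. x $ c *\<^sub>R ?D (axis (fst c) (axis (snd c) 1)))"
    using assms by (simp add: linear_sum linear_scale)
  then show ?thesis
    by (simp add: vec_eq_iff matrix_vector_mult_def rigidity_matrix_def sum_distrib_left mult_ac)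
qed

text \<open>The two null spaces are nested, so they have the same dimension exactly when the reverse inclusion
  holds; splitting the index pairs identifies them with the kernels of the derivatives.\<close>

lemma infinitesimally_rigid_iff_kernel_le:
  fixes E :: "'n::finite set set"
  assumes "simple_graph E" and diff: "\<And>i. h i differentiable (at (p $ i))"
  shows "infinitesimally_rigid h E p \<longleftrightarrow>
    (\<forall>v. aug_edge_deriv h E p v = 0 \<longrightarrow> aug_edge_deriv h complete_graph p v = 0)"
proof -
  have fd: "frechet_derivative (aug_edge_fun h F) (at p) = aug_edge_deriv h F p" for F
    using has_derivative_aug_edge_fun[OF diff] frechet_derivative_at by metis
  have "linear (aug_edge_deriv h F p)" for F
    using has_derivative_aug_edge_fun[OF diff] has_derivative_linear by blast
  then have mult: "rigidity_matrix h F p *v x = (1/2) *\<^sub>R aug_edge_deriv h F p (\<chi> i k. x $ (i, k))" for F x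
    using rigidity_matrix_mult fd by metis
  let ?N = "\<lambda>F. {x. rigidity_matrix h F p *v x = 0}"
  have sub: "subspace (?N F)" for F
    by (rule linear_subspace_kernel) simp
  have "?N complete_graph \<subseteq> ?N E"
  proof
    fix x assume "x \<in> ?N complete_graph"
    then show "x \<in> ?N E"
      using edge_proj_aug_edge_deriv[OF assms(1), of h p "\<chi> i k. x $ (i, k)"]
        linear_0[OF linear_edge_proj, of E]
      by (simp add: mult)
  qed
  then have "dim (?N E) = dim (?N complete_graph) \<longleftrightarrow> ?N E \<subseteq> ?N complete_graph"
    using subspace_dim_equal[OF sub sub, of complete_graph E] by auto
  then have "infinitesimally_rigid h E p \<longleftrightarrow> ?N E \<subseteq> ?N complete_graph"
    unfolding infinitesimally_rigid_def .
  also have "\<dots> \<longleftrightarrow> (\<forall>x :: real^('n \<times> 3). aug_edge_deriv h E p (\<chi> i k. x $ (i, k)) = 0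
      \<longrightarrow> aug_edge_deriv h complete_graph p (\<chi> i k. x $ (i, k)) = 0)"
    by (auto simp: mult)
  also have "\<dots> \<longleftrightarrow> (\<forall>v. aug_edge_deriv h E p v = 0 \<longrightarrow> aug_edge_deriv h complete_graph p v = 0)"
  proof -
    have "\<exists>x :: real^('n \<times> 3). v = (\<chi> i k. x $ (i, k))" for v :: "real^3^'n"
      by (rule exI[of _ "\<chi> c. v $ fst c $ snd c"]) (simp add: vec_eq_iff)
    then show ?thesis
      by metis
  qed
  finally show ?thesis .
qed

section \<open>Infinitesimal and continuous rigidity\<close>

text \<open>This carries \<open>fibre_of_maximal_rank\<close> over to augmented edge functions: the map is \<open>C\<^sup>1\<close> on the
  configurations with \<open>q $ i \<in> S i\<close>, and regularity bounds the rank near \<open>p\<close>.\<close>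

lemma regular_framework_fibre:
  fixes E :: "'n::finite set set" and h :: "'n \<Rightarrow> real^3 \<Rightarrow> real" and p :: "real^3^'n"
    and P :: "real^('n set + 'n) \<Rightarrow> 'c::euclidean_space"
  assumes S: "\<And>i. open (S i)" "\<And>i. p $ i \<in> S i"
    and C1: "\<And>i. C_k_on (Suc 0) (h i) (S i)"
    and reg: "regular_framework h E p"
    and "linear P"
    and ker: "\<And>v. P (aug_edge_deriv h E p v) = 0 \<Longrightarrow> aug_edge_deriv h E p v = 0"
  obtains W \<epsilon> g where "open W" "p \<in> W"
    and "\<And>q. q \<in> W \<Longrightarrow> P (aug_edge_fun h E q) = P (aug_edge_fun h E p)
      \<Longrightarrow> aug_edge_fun h E q = aug_edge_fun h E p"
    and "\<epsilon> > 0" "g 0 = p" "continuous_on (ball 0 \<epsilon>) g"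
    and "\<And>y i. y \<in> ball 0 \<epsilon> \<Longrightarrow> g y $ i \<in> S i"
    and "(g has_derivative (\<lambda>v. v)) (at 0)"
    and "\<And>y. y \<in> ball 0 \<epsilon> \<Longrightarrow> aug_edge_deriv h E p y = 0
      \<Longrightarrow> aug_edge_fun h E (g y) = aug_edge_fun h E p"
proof -
  let ?B = "{q :: real^3^'n. \<forall>i. q $ i \<in> S i}"
  obtain N where "open N" "p \<in> N" and N: "\<And>q. q \<in> N \<Longrightarrow> derivative_rank h E q \<le> derivative_rank h E p"
    using reg by (auto simp: regular_framework_def)
  have "open ?B"
    using S by (intro open_vector_box) blast
  have der: "(aug_edge_fun h E has_derivative aug_edge_deriv h E q) (at q)" if "q \<in> ?B" for q
    using that C1 by (intro has_derivative_aug_edge_fun) auto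
  define f' where "f' q = Blinfun (aug_edge_deriv h E q)" for q
  have f': "blinfun_apply (f' q) = aug_edge_deriv h E q" if "q \<in> ?B" for q
    unfolding f'_def using der[OF that] has_derivative_bounded_linear bounded_linear_Blinfun_apply by blast
  have "continuous_on ?B f'"
  proof (rule continuous_on_blinfun_componentwise)
    fix v :: "real^3^'n"
    show "continuous_on ?B (\<lambda>q. f' q v)"
      by (rule continuous_on_eq[OF continuous_on_aug_edge_deriv[of h S E v, OF C1]]) (simp add: f')
  qed
  then have contf: "continuous_on (?B \<inter> N) f'"
    by (rule continuous_on_subset) blast
  have "p \<in> ?B"
    using S by simp
  have rank: "derivative_rank h E q = dim (range (blinfun_apply (f' q)))" if "q \<in> ?B" for q
    unfolding derivative_rank_def using frechet_derivative_at[OF der[OF that]] f'[OF that] by simp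
  have 1: "open (?B \<inter> N)" "p \<in> ?B \<inter> N"
    using \<open>open ?B\<close> \<open>open N\<close> \<open>p \<in> ?B\<close> \<open>p \<in> N\<close> by auto
  have 2: "(aug_edge_fun h E has_derivative blinfun_apply (f' q)) (at q)" if "q \<in> ?B \<inter> N" for q
    using der f' that by simp
  have 3: "dim (range (blinfun_apply (f' q))) \<le> dim (range (blinfun_apply (f' p)))" if "q \<in> ?B \<inter> N" for q
    using N[of q] rank \<open>p \<in> ?B\<close> that by simp
  have 4: "f' p v = 0" if "P (f' p v) = 0" for v
    using ker that f'[OF \<open>p \<in> ?B\<close>] by simp
  obtain W \<epsilon> g where *: "open W" "p \<in> W"
      "\<And>q. q \<in> W \<Longrightarrow> P (aug_edge_fun h E q) = P (aug_edge_fun h E p)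
        \<Longrightarrow> aug_edge_fun h E q = aug_edge_fun h E p"
      "\<epsilon> > 0" "g 0 = p" "continuous_on (ball 0 \<epsilon>) g"
    and g: "g ` ball 0 \<epsilon> \<subseteq> ?B \<inter> N"
    and der0: "(g has_derivative (\<lambda>v. v)) (at 0)"
    and fibre: "\<And>y. y \<in> ball 0 \<epsilon> \<Longrightarrow> f' p y = 0 \<Longrightarrow> aug_edge_fun h E (g y) = aug_edge_fun h E p"
    by (rule fibre_of_maximal_rank[OF 1 2 contf 3 \<open>linear P\<close> 4]) (assumption+, blast)
  show thesis
  proof (rule that[OF * _ der0])
    show "g y $ i \<in> S i" if "y \<in> ball 0 \<epsilon>" for y i
      using g that by blast
    show "aug_edge_fun h E (g y) = aug_edge_fun h E p"
      if "y \<in> ball 0 \<epsilon>" "aug_edge_deriv h E p y = 0" for y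
      using fibre that f'[OF \<open>p \<in> ?B\<close>] by simp
  qed
qed

text \<open>An infinitesimal motion \<open>v\<close> of a regular framework is the velocity of a motion inside the fibre; by
  continuous rigidity this motion preserves all distances for a short time, so its velocity is an
  infinitesimal motion of the complete framework.\<close>

lemma kernel_le_kernel_if_continuously_rigid:
  fixes E :: "'n::finite set set" and h :: "'n \<Rightarrow> real^3 \<Rightarrow> real" and p :: "real^3^'n"
  assumes "simple_graph E"
    and S: "\<And>i. open (S i)" "\<And>i. p $ i \<in> M \<inter> S i"
    and M: "\<And>i. M \<inter> S i = {y \<in> S i. h i y = 0}"
    and C1: "\<And>i. C_k_on (Suc 0) (h i) (S i)"
    and reg: "regular_framework h E p"
    and rigid: "continuously_rigid M E p"
    and v: "aug_edge_deriv h E p v = 0"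
  shows "aug_edge_deriv h complete_graph p v = 0"
proof -
  let ?K = "complete_graph :: 'n set set"
  have pS: "\<And>i. p $ i \<in> S i"
    using S by blast
  have diff: "\<And>i. h i differentiable (at (p $ i))"
    using C1 pS by auto
  obtain \<epsilon> g where "\<epsilon> > 0" "g 0 = p" "continuous_on (ball 0 \<epsilon>) g"
    and gS: "\<And>y i. y \<in> ball 0 \<epsilon> \<Longrightarrow> g y $ i \<in> S i"
    and derg: "(g has_derivative (\<lambda>v. v)) (at 0)"
    and fibre: "\<And>y. y \<in> ball 0 \<epsilon> \<Longrightarrow> aug_edge_deriv h E p y = 0
      \<Longrightarrow> aug_edge_fun h E (g y) = aug_edge_fun h E p"
    using regular_framework_fibre[OF S(1) pS C1 reg linear_ident] by metis
  have lin: "linear (aug_edge_deriv h F p)" for F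
    using has_derivative_aug_edge_fun[OF diff] has_derivative_linear by blast
  \<comment> \<open>The scaling by \<open>s\<close> keeps the whole segment from \<open>0\<close> to \<open>u\<close> inside the chart.\<close>
  define s where "s = \<epsilon> / (norm v + 1)"
  define u where "u = s *\<^sub>R v"
  have "s > 0"
    unfolding s_def using \<open>\<epsilon> > 0\<close> by (simp add: add_nonneg_pos)
  have "norm u < \<epsilon>"
    using \<open>\<epsilon> > 0\<close> by (simp add: u_def s_def divide_simps add_nonneg_pos)
  have u: "aug_edge_deriv h E p u = 0"
    using v by (simp add: u_def linear_scale[OF lin])
  have ball: "t *\<^sub>R u \<in> ball 0 \<epsilon>" if "t \<in> {0..1}" for t :: real
  proof -
    have "norm (t *\<^sub>R u) \<le> norm u"
      using that by (simp add: mult_left_le_one_le)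
    then show ?thesis
      using \<open>norm u < \<epsilon>\<close> by simp
  qed
  define \<gamma> where "\<gamma> t = g (t *\<^sub>R u)" for t :: real
  have V: "\<gamma> t \<in> V_on M E p" if "t \<in> {0..1}" for t
  proof -
    have "aug_edge_deriv h E p (t *\<^sub>R u) = 0"
      using u by (simp add: linear_scale[OF lin])
    then have "aug_edge_fun h E (\<gamma> t) = aug_edge_fun h E p"
      unfolding \<gamma>_def using fibre ball[OF that] by blast
    then show ?thesis
      using mem_V_on_iff_aug_edge_fun_eq[OF \<open>simple_graph E\<close> S(2) _ M] gS ball[OF that]
      by (simp add: \<gamma>_def)
  qed
  have "path \<gamma>"
    unfolding path_def \<gamma>_def
    by (rule continuous_on_compose2[OF \<open>continuous_on (ball 0 \<epsilon>) g\<close>])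
      (use ball in \<open>auto intro!: continuous_intros\<close>)
  moreover have "path_image \<gamma> \<subseteq> V_on M E p"
    using V by (auto simp: path_image_def)
  moreover have "pathstart \<gamma> = p"
    by (simp add: pathstart_def \<gamma>_def \<open>g 0 = p\<close>)
  ultimately obtain \<delta> where "\<delta> > 0" "\<delta> \<le> 1" and \<delta>: "\<gamma> ` {0..<\<delta>} \<subseteq> V_on M ?K p"
    using rigid unfolding continuously_rigid_def by blast
  have const: "aug_edge_fun h ?K (\<gamma> t) = aug_edge_fun h ?K p" if "t \<in> {0..\<delta>/2}" for t
  proof -
    have "t \<in> {0..<\<delta>}" "t \<in> {0..1}"
      using that \<open>\<delta> > 0\<close> \<open>\<delta> \<le> 1\<close> by auto
    then have "\<gamma> t \<in> V_on M ?K p"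
      using \<delta> by blast
    moreover have "simple_graph ?K"
      by (simp add: simple_graph_def complete_graph_def)
    ultimately show ?thesis
      using mem_V_on_iff_aug_edge_fun_eq[OF _ S(2) _ M] gS ball[OF \<open>t \<in> {0..1}\<close>]
      by (simp add: \<gamma>_def)
  qed
  let ?D = "aug_edge_deriv h ?K p u"
  have "((\<lambda>t. t *\<^sub>R u) has_derivative (\<lambda>t. t *\<^sub>R u)) (at (0::real))"
    by (auto intro!: derivative_eq_intros)
  then have "(\<gamma> has_derivative (\<lambda>t. t *\<^sub>R u)) (at 0)"
    unfolding \<gamma>_def by (rule has_derivative_compose) (simp add: derg)
  then have "((\<lambda>t. aug_edge_fun h ?K (\<gamma> t)) has_derivative (\<lambda>t. aug_edge_deriv h ?K p (t *\<^sub>R u))) (at 0)"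
    by (rule has_derivative_compose)
      (simp add: \<gamma>_def \<open>g 0 = p\<close> has_derivative_aug_edge_fun[OF diff])
  then have "((\<lambda>t. aug_edge_fun h ?K (\<gamma> t)) has_vector_derivative ?D) (at 0 within cbox 0 (\<delta>/2))"
    unfolding has_vector_derivative_def linear_scale[OF lin, of _ _ u]
    by (rule has_derivative_at_withinI)
  \<comment> \<open>On the short one-sided interval the same function is constant, and one-sided derivatives are
    unique.\<close>
  moreover have "((\<lambda>t. aug_edge_fun h ?K (\<gamma> t)) has_vector_derivative 0) (at 0 within cbox 0 (\<delta>/2))"
    using const \<open>\<delta> > 0\<close>
    by (intro has_vector_derivative_transform[OF _ _ has_vector_derivative_const]) auto
  ultimately have "?D = 0"
    using \<open>\<delta> > 0\<close> by (intro vector_derivative_unique_within_closed_interval) auto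
  then show ?thesis
    using \<open>s > 0\<close> by (simp add: u_def linear_scale[OF lin])
qed

text \<open>If \<open>E\<close> admits no more infinitesimal motions than the complete graph, then \<open>edge_proj E\<close> is injective
  on the range of the derivative for the complete graph. Regularity of the complete framework then
  makes all distances locally determined by the lengths of the edges in \<open>E\<close>.\<close>

lemma continuously_rigid_if_kernel_le_kernel:
  fixes E :: "'n::finite set set" and h :: "'n \<Rightarrow> real^3 \<Rightarrow> real" and p :: "real^3^'n"
  assumes "simple_graph E"
    and S: "\<And>i. open (S i)" "\<And>i. p $ i \<in> M \<inter> S i"
    and M: "\<And>i. M \<inter> S i = {y \<in> S i. h i y = 0}"
    and C1: "\<And>i. C_k_on (Suc 0) (h i) (S i)"
    and reg: "regular_framework h complete_graph p"
    and ker: "\<And>v. aug_edge_deriv h E p v = 0 \<Longrightarrow> aug_edge_deriv h complete_graph p v = 0"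
  shows "continuously_rigid M E p"
  unfolding continuously_rigid_def
proof (intro allI impI)
  let ?K = "complete_graph :: 'n set set"
  have pS: "\<And>i. p $ i \<in> S i"
    using S by blast
  have ker': "aug_edge_deriv h ?K p v = 0" if "edge_proj E (aug_edge_deriv h ?K p v) = 0" for v
    using ker that edge_proj_aug_edge_deriv[OF \<open>simple_graph E\<close>] by simp
  obtain W where "open W" "p \<in> W"
    and W: "\<And>q. q \<in> W \<Longrightarrow> edge_proj E (aug_edge_fun h ?K q) = edge_proj E (aug_edge_fun h ?K p)
      \<Longrightarrow> aug_edge_fun h ?K q = aug_edge_fun h ?K p"
    by (rule regular_framework_fibre[OF S(1) pS C1 reg linear_edge_proj ker']) (assumption+, blast)
  let ?B = "{q :: real^3^'n. \<forall>i. q $ i \<in> S i}"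
  have "open (?B \<inter> W)"
    using S \<open>open W\<close> by (intro open_Int open_vector_box) auto
  fix \<gamma> assume \<gamma>: "path \<gamma> \<and> path_image \<gamma> \<subseteq> V_on M E p \<and> pathstart \<gamma> = p"
  have "\<gamma> 0 \<in> ?B \<inter> W"
    using \<gamma> pS \<open>p \<in> W\<close> by (simp add: pathstart_def)
  moreover have "continuous_on {0..1} \<gamma>"
    using \<gamma> by (simp add: path_def)
  ultimately have "\<forall>\<^sub>F t in at 0 within {0..1}. \<gamma> t \<in> ?B \<inter> W"
    using \<open>open (?B \<inter> W)\<close>
    by (intro topological_tendstoD[of \<gamma> "\<gamma> 0"]) (auto simp: continuous_on_def)
  then obtain d where "d > 0" and d: "\<And>t. t \<in> {0..1} \<Longrightarrow> t \<noteq> 0 \<Longrightarrow> dist t 0 < d \<Longrightarrow> \<gamma> t \<in> ?B \<inter> W"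
    unfolding eventually_at by blast
  have "\<gamma> t \<in> V_on M ?K p" if "t \<in> {0..<min d 1}" for t
  proof -
    have t: "\<gamma> t \<in> ?B \<inter> W"
      using d[of t] that \<open>\<gamma> 0 \<in> ?B \<inter> W\<close> by (cases "t = 0") auto
    have "\<gamma> t \<in> V_on M E p"
      using \<gamma> that by (auto simp: path_image_def)
    then have "aug_edge_fun h E (\<gamma> t) = aug_edge_fun h E p"
      using mem_V_on_iff_aug_edge_fun_eq[OF \<open>simple_graph E\<close> S(2) _ M] t by blast
    then have "aug_edge_fun h ?K (\<gamma> t) = aug_edge_fun h ?K p"
      using W t edge_proj_aug_edge_fun[OF \<open>simple_graph E\<close>] by simp
    moreover have "simple_graph ?K"
      by (simp add: simple_graph_def complete_graph_def)
    ultimately show ?thesis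
      using mem_V_on_iff_aug_edge_fun_eq[OF _ S(2) _ M] t by blast
  qed
  then show "\<exists>\<delta>>0. \<delta> \<le> 1 \<and> \<gamma> ` {0..<\<delta>} \<subseteq> V_on M ?K p"
    using \<open>d > 0\<close> by (intro exI[of _ "min d 1"]) auto
qed

theorem theorem3p8:
  fixes M :: "(real^3) set" and E :: "'n::finite set set" and p :: "real^3^'n"
    and h :: "'n \<Rightarrow> real^3 \<Rightarrow> real"
  assumes "smooth_surface M"
    and "framework_on M E p"
    and "\<And>i. local_equation M (p $ i) (h i)"
    and "regular_framework h E p"
    and "regular_framework h complete_graph p"
  shows "infinitesimally_rigid h E p \<longleftrightarrow> continuously_rigid M E p"
proof -
  have simple: "simple_graph E" and pM: "\<And>i. p $ i \<in> M"
    using assms(2) by (auto simp: framework_on_def)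
  have "\<exists>S. \<forall>i. open (S i) \<and> p $ i \<in> S i \<and> smooth_on (h i) (S i) \<and> M \<inter> S i = {y \<in> S i. h i y = 0}"
    using assms(3) unfolding local_equation_def by (intro choice) blast
  then obtain S where S: "\<And>i. open (S i)" "\<And>i. p $ i \<in> M \<inter> S i"
    and M: "\<And>i. M \<inter> S i = {y \<in> S i. h i y = 0}"
    and smooth: "\<And>i. smooth_on (h i) (S i)"
    using pM by blast
  have C1: "\<And>i. C_k_on (Suc 0) (h i) (S i)"
    using smooth unfolding smooth_on_def by blast
  have "h i differentiable (at (p $ i))" for i
    using C1[of i] S(2)[of i] by simp
  then have "infinitesimally_rigid h E p \<longleftrightarrow>
      (\<forall>v. aug_edge_deriv h E p v = 0 \<longrightarrow> aug_edge_deriv h complete_graph p v = 0)"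
    by (rule infinitesimally_rigid_iff_kernel_le[OF simple])
  also have "\<dots> \<longleftrightarrow> continuously_rigid M E p"
    using kernel_le_kernel_if_continuously_rigid[OF simple S M C1 assms(4)]
      continuously_rigid_if_kernel_le_kernel[OF simple S M C1 assms(5)]
    by blast
  finally show ?thesis .
qed

end
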